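(* Let $\mathcal{L}$ be a left bialgebroid over an algebra $B$, with source $s$ and target $t$. Suppose there is an invertible linear map $S:\mathcal{L}\to\mathcal{L}$ such that for all $X\in\mathcal{L}$ and $b\in B$: (1) $S(t(b)X)=S(X)s(b)$ and $S^{-1}(s(b)X)=S^{-1}(X)t(b)$; (2) $S^{-1}(X_{(2)})_{(1)}\otimes_B S^{-1}(X_{(2)})_{(2)}X_{(1)}=S^{-1}(X)\otimes_B 1$; (3) $S(X_{(1)})_{(1)}X_{(2)}\otimes_B S(X_{(1)})_{(2)}=1\otimes_B S(X)$. Then $\mathcal{L}$ is a left Hopf algebroid, and the inverse of the map $\lambda(X\otimes_{B^{op}}Y)=X_{(1)}\otimes_BX_{(2)}Y$ is given by $$\lambda^{-1}(X\otimes_B Y)=S^{-1}(S(X)_{(2)})\otimes_{B^{op}}S(X)_{(1)}Y,\qquad X,Y\in\mathcal{L}.$$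
   Context: All algebras are unital over a field $k$; $\Delta(X)=X_{(1)}\otimes_BX_{(2)}$ is sumless Sweedler notation. Left $B$-bialgebroid: an algebra $\mathcal{L}$ with algebra maps $s:B\to\mathcal{L}$, $t:B^{op}\to\mathcal{L}$ with commuting images, and a $B$-coring structure $(\Delta,\epsilon)$ (coalgebra in $B$-bimodules) for the bimodule structure $b.X.c=s(b)t(c)X$, such that (i) $\Delta$ corestricts to an algebra map $\mathcal{L}\to\mathcal{L}\times_B\mathcal{L}=\{\sum_i X_i\otimes_B Y_i\mid \sum_i X_it(b)\otimes_B Y_i=\sum_i X_i\otimes_B Y_is(b)\ \forall b\in B\}\subseteq\mathcal{L}\otimes_B\mathcal{L}$ with factorwise product; (ii) $\epsilon(1)=1$, $\epsilon(s(b)X)=b\epsilon(X)$, $\epsilon(Xs(\epsilon(Y)))=\epsilon(XY)=\epsilon(Xt(\epsilon(Y)))$. Left Hopf algebroid: a left $B$-bialgebroid such that $\lambda:\mathcal{L}\otimes_{B^{op}}\mathcal{L}\to\mathcal{L}\otimes_B\mathcal{L}$, $\lambda(X\otimes_{B^{op}}Y)=X_{(1)}\otimes_B X_{(2)}Y$, is invertible, where $Xt(b)\otimes_{B^{op}}Y=X\otimes_{B^{op}}t(b)Y$ and $t(b)X\otimes_B Y=X\otimes_B s(b)Y$. *)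

theory Defs
  imports Complex_Main "HOL-Algebra.Free_Abelian_Groups"
begin

section \<open>Algebras over a field\<close>

(* The sort {ring, monoid_mult} is that of unital rings in which 0 = 1 is allowed (the class
   ring_1 would exclude the zero algebra). *)

locale unital_algebra = vector_space scale
  for scale :: "'k::field \<Rightarrow> 'a::{ring,monoid_mult} \<Rightarrow> 'a" +
  assumes scale_mult_left: "scale c x * y = scale c (x * y)"
    and scale_mult_right: "x * scale c y = scale c (x * y)"


section \<open>Balanced tensor products\<close>

(* The tensor product of a right B-module M and a left B-module N is the quotient of the free
   abelian group on M \<times> N by the usual relations; ract b x stands for x.b and lact b y for b.y.
   Following HOL-Algebra, this additive group is written multiplicatively, and its elements are
   the cosets of the subgroup of relations.  When B acts through a k-algebra, the k-linear
   structure of the quotient is induced by the action of the scalars k.1 of B, so that no separate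
   relation for the scalars is needed. *)

definition tensor_rels ::
  "('b \<Rightarrow> 'm \<Rightarrow> 'm) \<Rightarrow> ('b \<Rightarrow> 'n \<Rightarrow> 'n) \<Rightarrow> ('m::ab_group_add \<times> 'n::ab_group_add \<Rightarrow>\<^sub>0 int) set"
  where "tensor_rels ract lact =
    {frag_of (x + x', y) - frag_of (x, y) - frag_of (x', y) | x x' y. True} \<union>
    {frag_of (x, y + y') - frag_of (x, y) - frag_of (x, y') | x y y'. True} \<union>
    {frag_of (ract b x, y) - frag_of (x, lact b y) | b x y. True}"

definition tensor_product ::
  "('b \<Rightarrow> 'm \<Rightarrow> 'm) \<Rightarrow> ('b \<Rightarrow> 'n \<Rightarrow> 'n) \<Rightarrow> ('m::ab_group_add \<times> 'n::ab_group_add \<Rightarrow>\<^sub>0 int) set monoid"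
  where "tensor_product ract lact =
    free_Abelian_group UNIV Mod generate (free_Abelian_group UNIV) (tensor_rels ract lact)"

definition pure_tensor ::
  "('b \<Rightarrow> 'm \<Rightarrow> 'm) \<Rightarrow> ('b \<Rightarrow> 'n \<Rightarrow> 'n) \<Rightarrow> 'm::ab_group_add \<Rightarrow> 'n::ab_group_add
    \<Rightarrow> ('m \<times> 'n \<Rightarrow>\<^sub>0 int) set"
  where "pure_tensor ract lact x y =
    generate (free_Abelian_group UNIV) (tensor_rels ract lact)
      #>\<^bsub>free_Abelian_group UNIV\<^esub> frag_of (x, y)"

(* The threefold product M \<otimes> N \<otimes> P, as a quotient of the free abelian group on triples. *)

definition tensor3_rels ::
  "('b \<Rightarrow> 'm \<Rightarrow> 'm) \<Rightarrow> ('b \<Rightarrow> 'n \<Rightarrow> 'n) \<Rightarrow> ('b \<Rightarrow> 'n \<Rightarrow> 'n) \<Rightarrow> ('b \<Rightarrow> 'p \<Rightarrow> 'p)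
    \<Rightarrow> ('m::ab_group_add \<times> 'n::ab_group_add \<times> 'p::ab_group_add \<Rightarrow>\<^sub>0 int) set"
  where "tensor3_rels ract lact ract' lact' =
    {frag_of (x + x', y, z) - frag_of (x, y, z) - frag_of (x', y, z) | x x' y z. True} \<union>
    {frag_of (x, y + y', z) - frag_of (x, y, z) - frag_of (x, y', z) | x y y' z. True} \<union>
    {frag_of (x, y, z + z') - frag_of (x, y, z) - frag_of (x, y, z') | x y z z'. True} \<union>
    {frag_of (ract b x, y, z) - frag_of (x, lact b y, z) | b x y z. True} \<union>
    {frag_of (x, ract' b y, z) - frag_of (x, y, lact' b z) | b x y z. True}"

definition tensor3_product ::
  "('b \<Rightarrow> 'm \<Rightarrow> 'm) \<Rightarrow> ('b \<Rightarrow> 'n \<Rightarrow> 'n) \<Rightarrow> ('b \<Rightarrow> 'n \<Rightarrow> 'n) \<Rightarrow> ('b \<Rightarrow> 'p \<Rightarrow> 'p)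
    \<Rightarrow> ('m::ab_group_add \<times> 'n::ab_group_add \<times> 'p::ab_group_add \<Rightarrow>\<^sub>0 int) set monoid"
  where "tensor3_product ract lact ract' lact' =
    free_Abelian_group UNIV Mod
      generate (free_Abelian_group UNIV) (tensor3_rels ract lact ract' lact')"

definition pure_tensor3 ::
  "('b \<Rightarrow> 'm \<Rightarrow> 'm) \<Rightarrow> ('b \<Rightarrow> 'n \<Rightarrow> 'n) \<Rightarrow> ('b \<Rightarrow> 'n \<Rightarrow> 'n) \<Rightarrow> ('b \<Rightarrow> 'p \<Rightarrow> 'p)
    \<Rightarrow> 'm::ab_group_add \<Rightarrow> 'n::ab_group_add \<Rightarrow> 'p::ab_group_add \<Rightarrow> ('m \<times> 'n \<times> 'p \<Rightarrow>\<^sub>0 int) set"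
  where "pure_tensor3 ract lact ract' lact' x y z =
    generate (free_Abelian_group UNIV) (tensor3_rels ract lact ract' lact')
      #>\<^bsub>free_Abelian_group UNIV\<^esub> frag_of (x, y, z)"

definition additive_group :: "'a::ab_group_add monoid"
  where "additive_group = \<lparr>carrier = UNIV, mult = (+), one = 0\<rparr>"

(* tensor_lift G f is the additive map into the abelian group G that sends the class of a
   generator g to f g; it is well defined as soon as f respects the relations (see
   tensor_lift_balanced below).  It renders sumless Sweedler notation: if A = A1 \<otimes> A2 is an element of a tensor product,
   tensor_lift G (\<lambda>(A1, A2). f A1 A2) A is what is written f A1 A2 in sumless notation. *)

definition tensor_lift ::
  "('g, 'r) monoid_scheme \<Rightarrow> ('x \<Rightarrow> 'g) \<Rightarrow> ('x \<Rightarrow>\<^sub>0 int) set \<Rightarrow> 'g"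
  where "tensor_lift G f A = the_elem
    ((\<lambda>p. finprod G (\<lambda>x. f x [^]\<^bsub>G\<^esub> Poly_Mapping.lookup p x) (Poly_Mapping.keys p)) ` A)"


lemma tensor_lift_quotient:
  fixes G :: "('g, 'r) monoid_scheme" and f :: "'x \<Rightarrow> 'g" and R :: "('x \<Rightarrow>\<^sub>0 int) set"
  defines "F \<equiv> free_Abelian_group (UNIV :: 'x set)"
  assumes G: "comm_group G" and f: "\<And>x. f x \<in> carrier G"
    and h: "h \<in> hom F G" "\<And>x. h (frag_of x) = f x"
    and R: "\<And>r. r \<in> R \<Longrightarrow> h r = \<one>\<^bsub>G\<^esub>"
  shows "tensor_lift G f \<in> hom (F Mod generate F R) G"
    and "tensor_lift G f (generate F R #>\<^bsub>F\<^esub> p) = h p"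
proof -
  interpret G: comm_group G by (rule G)
  interpret F: comm_group F unfolding F_def by (rule abelian_free_Abelian_group)
  interpret h: group_hom F G h
    using h(1) by unfold_locales
  have carF [simp]: "carrier F = UNIV" and multF [simp]: "\<And>x y. x \<otimes>\<^bsub>F\<^esub> y = x + y"
    by (auto simp: F_def)
  define e where "e p = finprod G (\<lambda>x. f x [^]\<^bsub>G\<^esub> Poly_Mapping.lookup p x) (Poly_Mapping.keys p)"
    for p :: "'x \<Rightarrow>\<^sub>0 int"
  have e_superset: "e p = finprod G (\<lambda>x. f x [^]\<^bsub>G\<^esub> Poly_Mapping.lookup p x) K"
    if "finite K" "Poly_Mapping.keys p \<subseteq> K" for p K
    unfolding e_def
    by (rule G.finprod_mono_neutral_cong_left) (use that f in \<open>auto simp: in_keys_iff\<close>)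
  have e_diff: "e (p - q) = e p \<otimes>\<^bsub>G\<^esub> inv\<^bsub>G\<^esub> e q" for p q
  proof -
    let ?K = "Poly_Mapping.keys p \<union> Poly_Mapping.keys q"
    have "e (p - q) \<otimes>\<^bsub>G\<^esub> e q = e p"
      using keys_diff[of p q] f
      by (simp add: e_superset[of ?K] G.finprod_multf [symmetric] lookup_minus
          G.int_pow_mult [symmetric] Pi_def)
    moreover have "e r \<in> carrier G" for r
      unfolding e_def using f by (intro G.finprod_closed) auto
    ultimately show ?thesis
      by (metis G.inv_solve_right)
  qed
  have eh: "e p = h p" for p
  proof (rule free_Abelian_group_induct[of p UNIV])
    show "e 0 = h 0"
      using h.hom_one by (simp add: e_def F_def)
    show "e (x - y) = h (x - y)" if "e x = h x" "e y = h y" for x y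
    proof -
      have "h (x - y) \<otimes>\<^bsub>G\<^esub> h y = h x"
        using h.hom_mult[of "x - y" y] by simp
      then show ?thesis
        using that e_diff[of x y] by (metis G.inv_solve_right h.hom_closed carF UNIV_I)
    qed
    show "e (frag_of a) = h (frag_of a)" for a
      using f h(2) by (simp add: e_def G.int_pow_1 Pi_def)
  qed simp
  have N: "generate F R \<lhd> F"
    by (intro F.subgroup_imp_normal F.generate_is_subgroup) simp
  have "R \<subseteq> kernel F G h"
    using R by (auto simp: kernel_def)
  then have ker: "generate F R \<subseteq> kernel F G h"
    by (intro F.generate_subgroup_incl h.subgroup_kernel)
  obtain g where g: "g \<in> hom (F Mod generate F R) G" "\<And>p. g (generate F R #>\<^bsub>F\<^esub> p) = h p"
    using h.FactGroup_universal_kernel[OF N ker] by auto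
  show lift: "tensor_lift G f (generate F R #>\<^bsub>F\<^esub> p) = h p" for p
  proof -
    have "e ` (generate F R #>\<^bsub>F\<^esub> p) = {h p}"
    proof -
      have "h (n \<otimes>\<^bsub>F\<^esub> p) = h p" if "n \<in> generate F R" for n
        using that ker h.hom_mult[of n p] h.hom_closed[of p] by (auto simp: kernel_def simp del: multF)
      moreover have "generate F R \<noteq> {}"
        using generate.one by auto
      ultimately show ?thesis
        unfolding r_coset_def eh by (auto simp: image_UN)
    qed
    then show ?thesis
      by (simp add: tensor_lift_def e_def [symmetric])
  qed
  have "tensor_lift G f A = g A" if "A \<in> carrier (F Mod generate F R)" for A
    using that lift g(2) by (auto simp: carrier_FactGroup)
  moreover have "A \<otimes>\<^bsub>F Mod generate F R\<^esub> B \<in> carrier (F Mod generate F R)"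
    if "A \<in> carrier (F Mod generate F R)" "B \<in> carrier (F Mod generate F R)" for A B
    using that normal.factorgroup_is_group[OF N] by (metis group.is_monoid monoid.m_closed)
  ultimately show "tensor_lift G f \<in> hom (F Mod generate F R) G"
    using g(1) by (auto simp: hom_def Pi_def)
qed

lemma tensor_lift_balanced:
  fixes G :: "('g, 'r) monoid_scheme"
    and f :: "'m::ab_group_add \<times> 'n::ab_group_add \<Rightarrow> 'g"
  assumes G: "comm_group G" and f: "\<And>x. f x \<in> carrier G"
    and "\<And>x x' y. f (x + x', y) = f (x, y) \<otimes>\<^bsub>G\<^esub> f (x', y)"
    and "\<And>x y y'. f (x, y + y') = f (x, y) \<otimes>\<^bsub>G\<^esub> f (x, y')"
    and "\<And>b x y. f (ract b x, y) = f (x, lact b y)"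
  shows "tensor_lift G f \<in> hom (tensor_product ract lact) G"
    and "tensor_lift G f (pure_tensor ract lact x y) = f (x, y)"
proof -
  interpret G: comm_group G by (rule G)
  obtain h where h: "h \<in> hom (free_Abelian_group UNIV) G" "\<And>x. h (frag_of x) = f x"
    using G.free_Abelian_group_universal[of f UNIV] f by (metis UNIV_I image_subsetI)
  interpret h: group_hom "free_Abelian_group UNIV" G h
    using h(1) by (simp add: group_hom_def group_hom_axioms_def G.is_group)
  have h_diff: "h (p - q) = h p \<otimes>\<^bsub>G\<^esub> inv\<^bsub>G\<^esub> h q" for p q
    using h.hom_mult[of p "- q"] h.hom_inv[of q] by simp
  have cancel: "a \<otimes>\<^bsub>G\<^esub> (b \<otimes>\<^bsub>G\<^esub> (inv\<^bsub>G\<^esub> a \<otimes>\<^bsub>G\<^esub> inv\<^bsub>G\<^esub> b)) = \<one>\<^bsub>G\<^esub>"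
    if "a \<in> carrier G" "b \<in> carrier G" for a b
    using that by (simp add: G.inv_mult [symmetric] G.m_assoc [symmetric])
  have "h r = \<one>\<^bsub>G\<^esub>" if "r \<in> tensor_rels ract lact" for r
    using that assms(2-) by (auto simp: tensor_rels_def h_diff h(2) G.m_ac cancel)
  note * = tensor_lift_quotient[OF G f h this]
  show "tensor_lift G f \<in> hom (tensor_product ract lact) G"
    using *(1) by (simp add: tensor_product_def)
  show "tensor_lift G f (pure_tensor ract lact x y) = f (x, y)"
    using *(2)[of _ "frag_of (x, y)"] by (simp add: pure_tensor_def h(2))
qed


section \<open>Left bialgebroids\<close>

(* L \<otimes>_B L, with t(b)X \<otimes> Y = X \<otimes> s(b)Y *)

definition tensB :: "('b \<Rightarrow> 'l::{ring,monoid_mult}) \<Rightarrow> ('b \<Rightarrow> 'l) \<Rightarrow> ('l \<times> 'l \<Rightarrow>\<^sub>0 int) set monoid"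
  where "tensB s t = tensor_product (\<lambda>b X. t b * X) (\<lambda>b Y. s b * Y)"

definition pureB :: "('b \<Rightarrow> 'l::{ring,monoid_mult}) \<Rightarrow> ('b \<Rightarrow> 'l) \<Rightarrow> 'l \<Rightarrow> 'l \<Rightarrow> ('l \<times> 'l \<Rightarrow>\<^sub>0 int) set"
  where "pureB s t = pure_tensor (\<lambda>b X. t b * X) (\<lambda>b Y. s b * Y)"

definition tens3B ::
  "('b \<Rightarrow> 'l::{ring,monoid_mult}) \<Rightarrow> ('b \<Rightarrow> 'l) \<Rightarrow> ('l \<times> 'l \<times> 'l \<Rightarrow>\<^sub>0 int) set monoid"
  where "tens3B s t = tensor3_product
    (\<lambda>b X. t b * X) (\<lambda>b Y. s b * Y) (\<lambda>b Y. t b * Y) (\<lambda>b Z. s b * Z)"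

definition pure3B ::
  "('b \<Rightarrow> 'l::{ring,monoid_mult}) \<Rightarrow> ('b \<Rightarrow> 'l) \<Rightarrow> 'l \<Rightarrow> 'l \<Rightarrow> 'l \<Rightarrow> ('l \<times> 'l \<times> 'l \<Rightarrow>\<^sub>0 int) set"
  where "pure3B s t = pure_tensor3
    (\<lambda>b X. t b * X) (\<lambda>b Y. s b * Y) (\<lambda>b Y. t b * Y) (\<lambda>b Z. s b * Z)"

(* L \<otimes>_{B^op} L, with Xt(b) \<otimes> Y = X \<otimes> t(b)Y *)

definition tensBop :: "('b \<Rightarrow> 'l::{ring,monoid_mult}) \<Rightarrow> ('l \<times> 'l \<Rightarrow>\<^sub>0 int) set monoid"
  where "tensBop t = tensor_product (\<lambda>b X. X * t b) (\<lambda>b Y. t b * Y)"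

definition pureBop :: "('b \<Rightarrow> 'l::{ring,monoid_mult}) \<Rightarrow> 'l \<Rightarrow> 'l \<Rightarrow> ('l \<times> 'l \<Rightarrow>\<^sub>0 int) set"
  where "pureBop t = pure_tensor (\<lambda>b X. X * t b) (\<lambda>b Y. t b * Y)"

(* The products (c \<otimes> d)A and A(c \<otimes> d), taken factorwise.  The first is used only when it is well
   defined on L \<otimes>_B L, namely for c in the image of s and d in the image of t. *)

definition lmultB ::
  "('b \<Rightarrow> 'l::{ring,monoid_mult}) \<Rightarrow> ('b \<Rightarrow> 'l) \<Rightarrow> 'l \<Rightarrow> 'l
    \<Rightarrow> ('l \<times> 'l \<Rightarrow>\<^sub>0 int) set \<Rightarrow> ('l \<times> 'l \<Rightarrow>\<^sub>0 int) set"
  where "lmultB s t c d = tensor_lift (tensB s t) (\<lambda>(X, Y). pureB s t (c * X) (d * Y))"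

definition rmultB ::
  "('b \<Rightarrow> 'l::{ring,monoid_mult}) \<Rightarrow> ('b \<Rightarrow> 'l) \<Rightarrow> 'l \<Rightarrow> 'l
    \<Rightarrow> ('l \<times> 'l \<Rightarrow>\<^sub>0 int) set \<Rightarrow> ('l \<times> 'l \<Rightarrow>\<^sub>0 int) set"
  where "rmultB s t c d = tensor_lift (tensB s t) (\<lambda>(X, Y). pureB s t (X * c) (Y * d))"

definition takeuchi ::
  "('b \<Rightarrow> 'l::{ring,monoid_mult}) \<Rightarrow> ('b \<Rightarrow> 'l) \<Rightarrow> ('l \<times> 'l \<Rightarrow>\<^sub>0 int) set set"
  where "takeuchi s t =
    {A \<in> carrier (tensB s t). \<forall>b. rmultB s t (t b) 1 A = rmultB s t 1 (s b) A}"

(* The factorwise product AC of A and C in the Takeuchi product: the class of c \<otimes> d in C is mapped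
   to A(c \<otimes> d).  That A lies in the Takeuchi product makes this well defined in C. *)

definition takeuchi_mult ::
  "('b \<Rightarrow> 'l::{ring,monoid_mult}) \<Rightarrow> ('b \<Rightarrow> 'l)
    \<Rightarrow> ('l \<times> 'l \<Rightarrow>\<^sub>0 int) set \<Rightarrow> ('l \<times> 'l \<Rightarrow>\<^sub>0 int) set \<Rightarrow> ('l \<times> 'l \<Rightarrow>\<^sub>0 int) set"
  where "takeuchi_mult s t A C = tensor_lift (tensB s t) (\<lambda>(c, d). rmultB s t c d A) C"

locale left_bialgebroid =
  B: unital_algebra scaleB + L: unital_algebra scaleL
  for scaleB :: "'k::field \<Rightarrow> 'b::{ring,monoid_mult} \<Rightarrow> 'b"
    and scaleL :: "'k \<Rightarrow> 'l::{ring,monoid_mult} \<Rightarrow> 'l" +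
  fixes s t :: "'b \<Rightarrow> 'l"
    and \<Delta> :: "'l \<Rightarrow> ('l \<times> 'l \<Rightarrow>\<^sub>0 int) set"
    and \<epsilon> :: "'l \<Rightarrow> 'b"
  \<comment> \<open>source and target\<close>
  assumes s_linear: "Vector_Spaces.linear scaleB scaleL s"
    and s_mult: "s (b * c) = s b * s c"
    and s_one: "s 1 = 1"
    and t_linear: "Vector_Spaces.linear scaleB scaleL t"
    and t_mult: "t (b * c) = t c * t b"
    and t_one: "t 1 = 1"
    and s_t_commute: "s b * t c = t c * s b"
  \<comment> \<open>coring, for the bimodule structure b.X.c = s(b)t(c)X\<close>
    and Delta_closed: "\<Delta> X \<in> carrier (tensB s t)"
    and Delta_add: "\<Delta> (X + Y) = \<Delta> X \<otimes>\<^bsub>tensB s t\<^esub> \<Delta> Y"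
    and Delta_bimod: "\<Delta> (s b * t c * X) = lmultB s t (s b) (t c) (\<Delta> X)"
    and eps_linear: "Vector_Spaces.linear scaleL scaleB \<epsilon>"
    and eps_bimod: "\<epsilon> (s b * t c * X) = b * \<epsilon> X * c"
    and coassoc:
      "tensor_lift (tens3B s t)
         (\<lambda>(X1, X2). tensor_lift (tens3B s t) (\<lambda>(U, V). pure3B s t U V X2) (\<Delta> X1)) (\<Delta> X) =
       tensor_lift (tens3B s t)
         (\<lambda>(X1, X2). tensor_lift (tens3B s t) (\<lambda>(U, V). pure3B s t X1 U V) (\<Delta> X2)) (\<Delta> X)"
    and counit_left: "tensor_lift additive_group (\<lambda>(X1, X2). s (\<epsilon> X1) * X2) (\<Delta> X) = X"
    and counit_right: "tensor_lift additive_group (\<lambda>(X1, X2). t (\<epsilon> X2) * X1) (\<Delta> X) = X"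
  \<comment> \<open>compatibility of the coring with the algebra\<close>
    and Delta_takeuchi: "\<Delta> X \<in> takeuchi s t"
    and Delta_mult: "\<Delta> (X * Y) = takeuchi_mult s t (\<Delta> X) (\<Delta> Y)"
    and Delta_one: "\<Delta> 1 = pureB s t 1 1"
    and eps_one: "\<epsilon> 1 = 1"
    and eps_s: "\<epsilon> (s b * X) = b * \<epsilon> X"
    and eps_mult_s: "\<epsilon> (X * s (\<epsilon> Y)) = \<epsilon> (X * Y)"
    and eps_mult_t: "\<epsilon> (X * t (\<epsilon> Y)) = \<epsilon> (X * Y)"


section \<open>Left Hopf algebroids\<close>

definition galois_map ::
  "('b \<Rightarrow> 'l::{ring,monoid_mult}) \<Rightarrow> ('b \<Rightarrow> 'l) \<Rightarrow> ('l \<Rightarrow> ('l \<times> 'l \<Rightarrow>\<^sub>0 int) set)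
    \<Rightarrow> ('l \<times> 'l \<Rightarrow>\<^sub>0 int) set \<Rightarrow> ('l \<times> 'l \<Rightarrow>\<^sub>0 int) set"
  where "galois_map s t \<Delta> = tensor_lift (tensB s t)
    (\<lambda>(X, Y). tensor_lift (tensB s t) (\<lambda>(X1, X2). pureB s t X1 (X2 * Y)) (\<Delta> X))"

locale left_hopf_algebroid = left_bialgebroid +
  assumes galois_iso: "galois_map s t \<Delta> \<in> iso (tensBop t) (tensB s t)"


end

theory Submission
  imports Defs
begin

text \<open>Condition (1) is what makes the maps \<open>X \<otimes> Y \<mapsto> S\<^sup>-\<^sup>1(S(X)\<^sub>2) \<otimes> S(X)\<^sub>1Y\<close>
  and those on the left of (2) and (3) balanced. Applying (2) to \<open>S(X)\<close> and multiplying the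
  second factor by \<open>Y\<close> shows that the proposed map is a right inverse of \<open>\<lambda>\<close>; applying
  \<open>A \<otimes> B \<mapsto> S\<^sup>-\<^sup>1(B) \<otimes> AY\<close> to (3) shows that it is a left inverse.\<close>

section \<open>Maps out of balanced tensor products\<close>

text \<open>Bundles the conditions under which \<open>tensor_lift\<close> is well defined, so that
  balancedness can be passed on as one fact.\<close>

definition balanced_map ::
  "('b \<Rightarrow> 'm \<Rightarrow> 'm) \<Rightarrow> ('b \<Rightarrow> 'n \<Rightarrow> 'n) \<Rightarrow> ('g, 'r) monoid_scheme
    \<Rightarrow> ('m::ab_group_add \<times> 'n::ab_group_add \<Rightarrow> 'g) \<Rightarrow> bool"
  where "balanced_map ract lact G f \<longleftrightarrow>
    (\<forall>x. f x \<in> carrier G) \<and>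
    (\<forall>x x' y. f (x + x', y) = f (x, y) \<otimes>\<^bsub>G\<^esub> f (x', y)) \<and>
    (\<forall>x y y'. f (x, y + y') = f (x, y) \<otimes>\<^bsub>G\<^esub> f (x, y')) \<and>
    (\<forall>b x y. f (ract b x, y) = f (x, lact b y))"

lemma balanced_mapI:
  assumes "\<And>x y. f (x, y) \<in> carrier G"
    and "\<And>x x' y. f (x + x', y) = f (x, y) \<otimes>\<^bsub>G\<^esub> f (x', y)"
    and "\<And>x y y'. f (x, y + y') = f (x, y) \<otimes>\<^bsub>G\<^esub> f (x, y')"
    and "\<And>b x y. f (ract b x, y) = f (x, lact b y)"
  shows "balanced_map ract lact G f"
  using assms by (auto simp: balanced_map_def)

lemma balanced_lift_hom:
  assumes "comm_group G" "balanced_map ract lact G f"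
  shows "tensor_lift G f \<in> hom (tensor_product ract lact) G"
  using assms by (intro tensor_lift_balanced(1)) (auto simp: balanced_map_def)

lemma balanced_lift_pure:
  assumes "comm_group G" "balanced_map ract lact G f"
  shows "tensor_lift G f (pure_tensor ract lact x y) = f (x, y)"
  using assms by (intro tensor_lift_balanced(2)) (auto simp: balanced_map_def)

lemma normal_generate_free_Abelian_group:
  "generate (free_Abelian_group UNIV) R \<lhd> free_Abelian_group (UNIV :: 'x set)"
proof -
  interpret F: comm_group "free_Abelian_group (UNIV :: 'x set)"
    by (rule abelian_free_Abelian_group)
  show ?thesis
    by (intro F.subgroup_imp_normal F.generate_is_subgroup) (auto simp: free_Abelian_group_def)
qed

lemma carrier_tensor_product:
  "A \<in> carrier (tensor_product ract lact) \<longleftrightarrow>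
    (\<exists>p. A = generate (free_Abelian_group UNIV) (tensor_rels ract lact)
      #>\<^bsub>free_Abelian_group UNIV\<^esub> p)"
  by (auto simp: tensor_product_def carrier_FactGroup)

lemma mult_tensor_product:
  "(generate (free_Abelian_group UNIV) (tensor_rels ract lact) #>\<^bsub>free_Abelian_group UNIV\<^esub> p)
    \<otimes>\<^bsub>tensor_product ract lact\<^esub>
    (generate (free_Abelian_group UNIV) (tensor_rels ract lact) #>\<^bsub>free_Abelian_group UNIV\<^esub> q) =
    generate (free_Abelian_group UNIV) (tensor_rels ract lact)
      #>\<^bsub>free_Abelian_group UNIV\<^esub> (p + q)"
  unfolding tensor_product_def
  using normal.rcos_sum[OF normal_generate_free_Abelian_group, of p q "tensor_rels ract lact"]
  by simp

lemma comm_group_tensor_product [simp]: "comm_group (tensor_product ract lact)"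
proof -
  interpret group "tensor_product ract lact"
    unfolding tensor_product_def
    by (rule normal.factorgroup_is_group[OF normal_generate_free_Abelian_group])
  show ?thesis
    by (rule group_comm_groupI)
      (auto simp: carrier_tensor_product mult_tensor_product add.commute)
qed

text \<open>Turns a defining relation into an equation of tensors: \<open>p = (p - q) + q\<close>
  exhibits \<open>p\<close> as a member of the coset of \<open>q\<close>.\<close>

lemma tensor_class_eqI:
  assumes "p - q \<in> tensor_rels ract lact"
  shows "generate (free_Abelian_group UNIV) (tensor_rels ract lact)
      #>\<^bsub>free_Abelian_group UNIV\<^esub> p =
    generate (free_Abelian_group UNIV) (tensor_rels ract lact)
      #>\<^bsub>free_Abelian_group UNIV\<^esub> q"
proof -
  let ?F = "free_Abelian_group UNIV"
    and ?H = "generate (free_Abelian_group UNIV) (tensor_rels ract lact)"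
  have "(p - q) + q \<in> ?H #>\<^bsub>?F\<^esub> q"
    using generate.incl[OF assms, of ?F] unfolding r_coset_def by force
  then have "?H #>\<^bsub>?F\<^esub> q = ?H #>\<^bsub>?F\<^esub> p"
    using group.repr_independence[of ?F p ?H q] normal_generate_free_Abelian_group
    by (auto simp: normal_def)
  then show ?thesis ..
qed

lemma balanced_pure_tensor:
  "balanced_map ract lact (tensor_product ract lact) (\<lambda>(x, y). pure_tensor ract lact x y)"
proof (rule balanced_mapI; unfold prod.case pure_tensor_def mult_tensor_product)
  show "generate (free_Abelian_group UNIV) (tensor_rels ract lact)
      #>\<^bsub>free_Abelian_group UNIV\<^esub> frag_of (x, y) \<in> carrier (tensor_product ract lact)" for x y
    by (auto simp: carrier_tensor_product)
\<comment> \<open>Each remaining condition is one family of relations; \<open>diff_diff_eq\<close>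
  regroups a - b - c as a - (b + c), the form in which sums of representatives appear.\<close>
qed (rule tensor_class_eqI; force simp: tensor_rels_def diff_diff_eq)+

text \<open>The cosets of the generators \<open>frag_of (x, y)\<close> are the pure tensors, so
  induction over the free abelian group reduces the claim to them.\<close>

lemma tensor_hom_eqI:
  assumes G: "group G"
    and h: "h \<in> hom (tensor_product ract lact) G" and k: "k \<in> hom (tensor_product ract lact) G"
    and eq: "\<And>x y. h (pure_tensor ract lact x y) = k (pure_tensor ract lact x y)"
    and A: "A \<in> carrier (tensor_product ract lact)"
  shows "h A = k A"
proof -
  interpret G: group G by (rule G)
  interpret T: comm_group "tensor_product ract lact" by simp
  interpret h: group_hom "tensor_product ract lact" G h
    using h by unfold_locales
  interpret k: group_hom "tensor_product ract lact" G k
    using k by unfold_locales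
  define c where "c p = generate (free_Abelian_group UNIV) (tensor_rels ract lact)
      #>\<^bsub>free_Abelian_group UNIV\<^esub> p" for p
  have closed: "c p \<in> carrier (tensor_product ract lact)" for p
    by (auto simp: c_def carrier_tensor_product)
  have c_add: "c (p + q) = c p \<otimes>\<^bsub>tensor_product ract lact\<^esub> c q" for p q
    by (simp add: c_def mult_tensor_product)
  obtain p where "A = c p"
    using A by (auto simp: carrier_tensor_product c_def)
  moreover have "h (c p) = k (c p)"
  proof (rule free_Abelian_group_induct[of p UNIV])
    have "c 0 = \<one>\<^bsub>tensor_product ract lact\<^esub>"
      using c_add[of 0 0] closed[of 0] by (simp add: T.r_cancel_one)
    then show "h (c 0) = k (c 0)"
      by simp
  next
    \<comment> \<open>The induction proceeds by differences, whereas \<open>c\<close> is known to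
      preserve sums; writing \<open>x\<close> as \<open>(x - y) + y\<close> allows
      \<open>h (c y)\<close> to be cancelled in \<open>G\<close>.\<close>
    fix x y assume eqs: "h (c x) = k (c x)" "h (c y) = k (c y)"
    have "c x = c (x - y) \<otimes>\<^bsub>tensor_product ract lact\<^esub> c y"
      using c_add[of "x - y" y] by simp
    then have "h (c (x - y)) \<otimes>\<^bsub>G\<^esub> h (c y) = k (c (x - y)) \<otimes>\<^bsub>G\<^esub> h (c y)"
      using eqs closed by (metis h.hom_mult k.hom_mult)
    then show "h (c (x - y)) = k (c (x - y))"
      using closed by (simp add: eqs)
  next
    show "h (c (frag_of a)) = k (c (frag_of a))" for a
      using eq[of "fst a" "snd a"] by (simp add: c_def pure_tensor_def)
  qed simp
  ultimately show ?thesis by simp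
qed

text \<open>The uniqueness half of the universal property; \<open>f\<close> inherits balancedness
  from the pure tensors through \<open>h\<close>.\<close>

lemma tensor_lift_eq_hom:
  assumes G: "comm_group G" and h: "h \<in> hom (tensor_product ract lact) G"
    and eq: "\<And>x y. f (x, y) = h (pure_tensor ract lact x y)"
    and A: "A \<in> carrier (tensor_product ract lact)"
  shows "tensor_lift G f A = h A"
proof -
  have bal: "balanced_map ract lact G f"
    using balanced_pure_tensor[of ract lact] h
    by (auto simp: balanced_map_def eq hom_def Pi_def)
  show ?thesis
    by (rule tensor_hom_eqI[OF comm_group.axioms(2)[OF G] balanced_lift_hom[OF G bal] h _ A])
      (simp add: balanced_lift_pure[OF G bal] eq)
qed

text \<open>By uniqueness of lifts, a homomorphism may be moved into a Sweedler expression or pulled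
  out of it.\<close>

lemma hom_tensor_lift:
  assumes G: "comm_group G" and H: "comm_group H" and k: "k \<in> hom G H"
    and bal: "balanced_map ract lact G f"
    and A: "A \<in> carrier (tensor_product ract lact)"
  shows "k (tensor_lift G f A) = tensor_lift H (\<lambda>x. k (f x)) A"
proof -
  have "tensor_lift H (\<lambda>x. k (f x)) A = (k \<circ> tensor_lift G f) A"
    by (rule tensor_lift_eq_hom[OF H hom_compose[OF balanced_lift_hom[OF G bal] k] _ A])
      (simp add: balanced_lift_pure[OF G bal])
  then show ?thesis by simp
qed

text \<open>Pointwise products of homomorphisms into a commutative group are homomorphisms. This
  serves to prove additivity in parameters, such as \<open>c\<close> and \<open>d\<close> in
  \<open>rmultB\<close>.\<close>

lemma tensor_lift_mult:
  assumes G: "comm_group G" and f: "balanced_map ract lact G f" and g: "balanced_map ract lact G g"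
    and A: "A \<in> carrier (tensor_product ract lact)"
  shows "tensor_lift G (\<lambda>x. f x \<otimes>\<^bsub>G\<^esub> g x) A = tensor_lift G f A \<otimes>\<^bsub>G\<^esub> tensor_lift G g A"
  by (rule tensor_lift_eq_hom[OF G comm_group.hom_group_mult[OF G balanced_lift_hom[OF G f]
        balanced_lift_hom[OF G g]] _ A])
    (simp add: balanced_lift_pure[OF G f] balanced_lift_pure[OF G g])


section \<open>Factorwise products in a left bialgebroid\<close>

lemma comm_group_tensB [simp]: "comm_group (tensB s t)"
  by (simp add: tensB_def)

lemma comm_group_tensBop [simp]: "comm_group (tensBop t)"
  by (simp add: tensBop_def)

lemmas balanced_pureB = balanced_pure_tensor[of "\<lambda>b X. t b * X" "\<lambda>b Y. s b * Y"
    for s t :: "_ \<Rightarrow> 'l::{ring,monoid_mult}", folded tensB_def pureB_def]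

lemmas balanced_pureBop = balanced_pure_tensor[of "\<lambda>b X. X * t b" "\<lambda>b Y. t b * Y"
    for t :: "_ \<Rightarrow> 'l::{ring,monoid_mult}", folded tensBop_def pureBop_def]

lemma pureB_closed [simp]: "pureB s t x y \<in> carrier (tensB s t)"
  and pureB_add_left: "pureB s t (x + x') y = pureB s t x y \<otimes>\<^bsub>tensB s t\<^esub> pureB s t x' y"
  and pureB_add_right: "pureB s t x (y + y') = pureB s t x y \<otimes>\<^bsub>tensB s t\<^esub> pureB s t x y'"
  and pureB_balanced: "pureB s t (t b * x) y = pureB s t x (s b * y)"
  using balanced_pureB[of t s] by (simp_all add: balanced_map_def)

lemma pureBop_closed [simp]: "pureBop t x y \<in> carrier (tensBop t)"
  and pureBop_add_left: "pureBop t (x + x') y = pureBop t x y \<otimes>\<^bsub>tensBop t\<^esub> pureBop t x' y"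
  and pureBop_add_right: "pureBop t x (y + y') = pureBop t x y \<otimes>\<^bsub>tensBop t\<^esub> pureBop t x y'"
  and pureBop_balanced: "pureBop t (x * t b) y = pureBop t x (t b * y)"
  using balanced_pureBop[of t] by (simp_all add: balanced_map_def)

abbreviation balancedB
  where "balancedB s t \<equiv> balanced_map (\<lambda>b X. t b * X) (\<lambda>b Y. s b * Y)"

abbreviation balancedBop
  where "balancedBop t \<equiv> balanced_map (\<lambda>b X. X * t b) (\<lambda>b Y. t b * Y)"

lemmas tensB_lift_hom = balanced_lift_hom[of _ "\<lambda>b X. t b * X" "\<lambda>b Y. s b * Y"
    for s t :: "_ \<Rightarrow> 'l::{ring,monoid_mult}", folded tensB_def]
  and tensB_lift_pure = balanced_lift_pure[of _ "\<lambda>b X. t b * X" "\<lambda>b Y. s b * Y"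
    for s t :: "_ \<Rightarrow> 'l::{ring,monoid_mult}", folded pureB_def]
  and tensB_hom_eqI = tensor_hom_eqI[of _ _ "\<lambda>b X. t b * X" "\<lambda>b Y. s b * Y"
    for s t :: "_ \<Rightarrow> 'l::{ring,monoid_mult}", folded tensB_def pureB_def]
  and tensB_hom_lift = hom_tensor_lift[of _ _ _ "\<lambda>b X. t b * X" "\<lambda>b Y. s b * Y"
    for s t :: "_ \<Rightarrow> 'l::{ring,monoid_mult}", folded tensB_def]
  and tensB_lift_mult = tensor_lift_mult[of _ "\<lambda>b X. t b * X" "\<lambda>b Y. s b * Y"
    for s t :: "_ \<Rightarrow> 'l::{ring,monoid_mult}", folded tensB_def]
  and tensBop_lift_hom = balanced_lift_hom[of _ "\<lambda>b X. X * t b" "\<lambda>b Y. t b * Y"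
    for t :: "_ \<Rightarrow> 'l::{ring,monoid_mult}", folded tensBop_def]
  and tensBop_lift_pure = balanced_lift_pure[of _ "\<lambda>b X. X * t b" "\<lambda>b Y. t b * Y"
    for t :: "_ \<Rightarrow> 'l::{ring,monoid_mult}", folded pureBop_def]
  and tensBop_hom_eqI = tensor_hom_eqI[of _ _ "\<lambda>b X. X * t b" "\<lambda>b Y. t b * Y"
    for t :: "_ \<Rightarrow> 'l::{ring,monoid_mult}", folded tensBop_def pureBop_def]

text \<open>\<open>B\<close> acts by left multiplication on both factors, which commutes with right
  multiplication; hence arbitrary \<open>c\<close> and \<open>d\<close> are allowed.\<close>

lemma balanced_rmultB: "balancedB s t (tensB s t) (\<lambda>(X, Y). pureB s t (X * c) (Y * d))"
  by (rule balanced_mapI)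
    (simp_all add: distrib_right pureB_add_left pureB_add_right pureB_balanced mult.assoc)

lemma rmultB_hom: "rmultB s t c d \<in> hom (tensB s t) (tensB s t)"
  unfolding rmultB_def by (intro tensB_lift_hom balanced_rmultB) simp

lemma rmultB_closed [simp]: "A \<in> carrier (tensB s t) \<Longrightarrow> rmultB s t c d A \<in> carrier (tensB s t)"
  using rmultB_hom[of s t c d] by (auto simp: hom_def)

lemma rmultB_mult:
  assumes "A \<in> carrier (tensB s t)" "C \<in> carrier (tensB s t)"
  shows "rmultB s t c d (A \<otimes>\<^bsub>tensB s t\<^esub> C) =
    rmultB s t c d A \<otimes>\<^bsub>tensB s t\<^esub> rmultB s t c d C"
  using rmultB_hom[of s t c d] assms by (simp add: hom_def)

lemma rmultB_pure [simp]: "rmultB s t c d (pureB s t x y) = pureB s t (x * c) (y * d)"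
  unfolding rmultB_def by (simp add: tensB_lift_pure[OF comm_group_tensB balanced_rmultB])

text \<open>Associativity on pure tensors. The operator applied first contributes the left-hand
  factors \<open>c'\<close> and \<open>d'\<close>.\<close>

lemma rmultB_rmultB:
  assumes "A \<in> carrier (tensB s t)"
  shows "rmultB s t c d (rmultB s t c' d' A) = rmultB s t (c' * c) (d' * d) A"
proof -
  have "(rmultB s t c d \<circ> rmultB s t c' d') A = rmultB s t (c' * c) (d' * d) A"
    by (rule tensB_hom_eqI[OF comm_group.axioms(2)[OF comm_group_tensB]
          hom_compose[OF rmultB_hom rmultB_hom] rmultB_hom _ assms])
      (simp add: mult.assoc)
  then show ?thesis by simp
qed

lemma rmultB_add_left:
  assumes "A \<in> carrier (tensB s t)"
  shows "rmultB s t (c + c') d A = rmultB s t c d A \<otimes>\<^bsub>tensB s t\<^esub> rmultB s t c' d A"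
  unfolding rmultB_def tensB_lift_mult[OF comm_group_tensB balanced_rmultB balanced_rmultB assms,
      symmetric]
  by (simp add: case_prod_unfold distrib_left pureB_add_left)

lemma rmultB_add_right:
  assumes "A \<in> carrier (tensB s t)"
  shows "rmultB s t c (d + d') A = rmultB s t c d A \<otimes>\<^bsub>tensB s t\<^esub> rmultB s t c d' A"
  unfolding rmultB_def tensB_lift_mult[OF comm_group_tensB balanced_rmultB balanced_rmultB assms,
      symmetric]
  by (simp add: case_prod_unfold distrib_left pureB_add_right)

text \<open>Multiplying A(t(b) \<otimes> 1) = A(1 \<otimes> s(b)) by c \<otimes> d on the right
  gives A(t(b)c \<otimes> d) = A(c \<otimes> s(b)d). So the map being lifted is balanced and the
  lift can be evaluated.\<close>

lemma takeuchi_mult_pure: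
  assumes "A \<in> takeuchi s t"
  shows "takeuchi_mult s t A (pureB s t c d) = rmultB s t c d A"
proof -
  have A: "A \<in> carrier (tensB s t)" "rmultB s t (t b) 1 A = rmultB s t 1 (s b) A" for b
    using assms by (auto simp: takeuchi_def)
  have "rmultB s t (t b * c) d A = rmultB s t c (s b * d) A" for b c d
    using rmultB_rmultB[OF A(1), of c d "t b" 1] rmultB_rmultB[OF A(1), of c d 1 "s b"] A(2)[of b]
    by simp
  then have "balancedB s t (tensB s t) (\<lambda>(c, d). rmultB s t c d A)"
    by (intro balanced_mapI) (simp_all add: A(1) rmultB_add_left rmultB_add_right)
  then show ?thesis
    by (simp add: takeuchi_mult_def tensB_lift_pure[OF comm_group_tensB])
qed

context left_bialgebroid
begin

text \<open>Left multiplication by s(b) \<otimes> t(c) respects the relations because the images of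
  \<open>s\<close> and \<open>t\<close> commute.\<close>

lemma lmultB_pure: "lmultB s t (s b) (t c) (pureB s t x y) = pureB s t (s b * x) (t c * y)"
proof -
  have "balancedB s t (tensB s t) (\<lambda>(X, Y). pureB s t (s b * X) (t c * Y))"
  proof (rule balanced_mapI)
    fix b' x y
    have "pureB s t (s b * (t b' * x)) (t c * y) = pureB s t (t b' * (s b * x)) (t c * y)"
      by (simp add: mult.assoc [symmetric] s_t_commute)
    also have "\<dots> = pureB s t (s b * x) (t c * (s b' * y))"
      by (simp add: pureB_balanced) (simp add: mult.assoc [symmetric] s_t_commute)
    finally show "(case (t b' * x, y) of (X, Y) \<Rightarrow> pureB s t (s b * X) (t c * Y)) =
        (case (x, s b' * y) of (X, Y) \<Rightarrow> pureB s t (s b * X) (t c * Y))"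
      by simp
  qed (simp_all add: distrib_left pureB_add_left pureB_add_right)
  then show ?thesis
    by (simp add: lmultB_def tensB_lift_pure[OF comm_group_tensB])
qed

lemma Delta_s: "\<Delta> (s b) = pureB s t (s b) 1"
  using Delta_bimod[of b 1 1] by (simp add: t_one Delta_one lmultB_pure[of b 1, simplified t_one])

lemma Delta_t: "\<Delta> (t b) = pureB s t 1 (t b)"
  using Delta_bimod[of 1 b 1] by (simp add: s_one Delta_one lmultB_pure[of 1 b, simplified s_one])

text \<open>Here and in \<open>Delta_mult_t\<close>, a scalar on the right of \<open>X\<close>
  becomes right multiplication on one leg of the coproduct. All balancedness checks that involve a
  coproduct rest on this.\<close>

lemma Delta_mult_s: "\<Delta> (X * s b) = rmultB s t (s b) 1 (\<Delta> X)"
  by (simp add: Delta_mult Delta_s takeuchi_mult_pure Delta_takeuchi)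

lemma Delta_mult_t: "\<Delta> (X * t b) = rmultB s t 1 (t b) (\<Delta> X)"
  by (simp add: Delta_mult Delta_t takeuchi_mult_pure Delta_takeuchi)

lemma galois_map_eq: "galois_map s t \<Delta> = tensor_lift (tensB s t) (\<lambda>(X, Y). rmultB s t 1 Y (\<Delta> X))"
  by (simp add: galois_map_def rmultB_def)

text \<open>The scalar in X t(b) reaches the second leg of the coproduct, where right multiplication
  by \<open>Y\<close> follows it: both sides are \<Delta>(X)(1 \<otimes> t(b)Y).\<close>

lemma balanced_galois: "balancedBop t (tensB s t) (\<lambda>(X, Y). rmultB s t 1 Y (\<Delta> X))"
  by (rule balanced_mapI)
    (simp_all add: Delta_closed Delta_add rmultB_mult rmultB_add_right Delta_mult_t rmultB_rmultB)

lemma galois_map_hom: "galois_map s t \<Delta> \<in> hom (tensBop t) (tensB s t)"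
  unfolding galois_map_eq by (intro tensBop_lift_hom balanced_galois) simp

lemma galois_map_pure: "galois_map s t \<Delta> (pureBop t X Y) = rmultB s t 1 Y (\<Delta> X)"
  unfolding galois_map_eq by (simp add: tensBop_lift_pure[OF comm_group_tensB balanced_galois])

end


section \<open>The inverse of the Galois map\<close>

theorem lemma3p3:
  fixes scaleB :: "'k::field \<Rightarrow> 'b::{ring,monoid_mult} \<Rightarrow> 'b"
    and scaleL :: "'k \<Rightarrow> 'l::{ring,monoid_mult} \<Rightarrow> 'l"
    and s t :: "'b \<Rightarrow> 'l"
    and \<Delta> :: "'l \<Rightarrow> ('l \<times> 'l \<Rightarrow>\<^sub>0 int) set"
    and \<epsilon> :: "'l \<Rightarrow> 'b"
    and S :: "'l \<Rightarrow> 'l"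
  assumes "left_bialgebroid scaleB scaleL s t \<Delta> \<epsilon>"
    and "Vector_Spaces.linear scaleL scaleL S"
    and "bij S"
    and "\<And>b X. S (t b * X) = S X * s b"
    and "\<And>b X. inv_into UNIV S (s b * X) = inv_into UNIV S X * t b"
    and "\<And>X. tensor_lift (tensB s t) (\<lambda>(X1, X2).
           tensor_lift (tensB s t) (\<lambda>(U, V). pureB s t U (V * X1)) (\<Delta> (inv_into UNIV S X2))) (\<Delta> X)
         = pureB s t (inv_into UNIV S X) 1"
    and "\<And>X. tensor_lift (tensB s t) (\<lambda>(X1, X2).
           tensor_lift (tensB s t) (\<lambda>(U, V). pureB s t (U * X2) V) (\<Delta> (S X1))) (\<Delta> X)
         = pureB s t 1 (S X)"
  shows "left_hopf_algebroid scaleB scaleL s t \<Delta> \<epsilon> \<and>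
    (\<forall>X Y. inv_into (carrier (tensBop t)) (galois_map s t \<Delta>) (pureB s t X Y)
       = tensor_lift (tensBop t) (\<lambda>(U, V). pureBop t (inv_into UNIV S V) (U * Y)) (\<Delta> (S X)))"
proof -
  interpret left_bialgebroid scaleB scaleL s t \<Delta> \<epsilon> by (rule assms(1))
  define R where "R = inv_into UNIV S"
  let ?T = "tensB s t" and ?O = "tensBop t" and ?gal = "galois_map s t \<Delta>"
  have SR [simp]: "S (R X) = X" and RS [simp]: "R (S X) = X" for X
    using \<open>bij S\<close> by (simp_all add: R_def bij_is_surj surj_f_inv_f bij_is_inj)
  have S_add: "S (X + Y) = S X + S Y" for X Y
    using assms(2) by (simp add: Vector_Spaces.linear_iff)
  have R_add: "R (X + Y) = R X + R Y" for X Y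
    by (metis SR RS S_add)
  have S_t: "S (t b * X) = S X * s b" and R_s: "R (s b * X) = R X * t b" for b X
    using assms(4,5) by (simp_all add: R_def)
  \<comment> \<open>In (2) and (3) the inner lift is a factorwise right multiplication of a
    coproduct, so both conditions are restated through \<open>rmultB\<close>.\<close>
  have cond2: "tensor_lift ?T (\<lambda>(X1, X2). rmultB s t 1 X1 (\<Delta> (R X2))) (\<Delta> X)
      = pureB s t (R X) 1" for X
    using assms(6)[of X] by (simp add: rmultB_def R_def)
  have cond3: "tensor_lift ?T (\<lambda>(X1, X2). rmultB s t X2 1 (\<Delta> (S X1))) (\<Delta> X)
      = pureB s t 1 (S X)" for X
    using assms(7)[of X] by (simp add: rmultB_def)
  \<comment> \<open>Both sides of the scalar relation equal \<Delta>(R(X2))(1 \<otimes> t(b)X1). In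
    \<open>bal3\<close> the common value is \<Delta>(S(X1))(s(b)X2 \<otimes> 1).\<close>
  have bal2: "balancedB s t ?T (\<lambda>(X1, X2). rmultB s t 1 X1 (\<Delta> (R X2)))"
    by (rule balanced_mapI)
      (simp_all add: Delta_closed rmultB_add_right R_add Delta_add rmultB_mult R_s Delta_mult_t
        rmultB_rmultB)
  have bal3: "balancedB s t ?T (\<lambda>(X1, X2). rmultB s t X2 1 (\<Delta> (S X1)))"
    by (rule balanced_mapI)
      (simp_all add: Delta_closed rmultB_add_left S_add Delta_add rmultB_mult S_t Delta_mult_s
        rmultB_rmultB)

  \<comment> \<open>\<open>twist Y\<close> flips the factors: U \<otimes> V goes to R(V) \<otimes>
    UY, so that \<open>twist Y (\<Delta> (S X))\<close> is the claimed value of the inverse. The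
    flip turns the relation over \<open>B\<close> into the one over its opposite, since R(s(b)V) =
    R(V)t(b).\<close>
  define twist where "twist Y = tensor_lift ?O (\<lambda>(U, V). pureBop t (R V) (U * Y))" for Y
  have twist_bal: "balancedB s t ?O (\<lambda>(U, V). pureBop t (R V) (U * Y))" for Y
    by (rule balanced_mapI)
      (simp_all add: distrib_right R_add pureBop_add_left pureBop_add_right R_s pureBop_balanced
        mult.assoc)
  have twist_hom: "twist Y \<in> hom ?T ?O" for Y
    unfolding twist_def by (intro tensB_lift_hom twist_bal) simp
  have twist_closed: "twist Y A \<in> carrier ?O" if "A \<in> carrier ?T" for Y A
    using twist_hom[of Y] that by (auto simp: hom_def)
  have twist_mult: "twist Y (A \<otimes>\<^bsub>?T\<^esub> C) = twist Y A \<otimes>\<^bsub>?O\<^esub> twist Y C"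
    if "A \<in> carrier ?T" "C \<in> carrier ?T" for Y A C
    using twist_hom[of Y] that by (simp add: hom_def)
  have twist_pure: "twist Y (pureB s t U V) = pureBop t (R V) (U * Y)" for U V Y
    unfolding twist_def by (simp add: tensB_lift_pure[OF comm_group_tensBop twist_bal])
  have twist_add: "twist (Y + Y') A = twist Y A \<otimes>\<^bsub>?O\<^esub> twist Y' A" if "A \<in> carrier ?T" for Y Y' A
    unfolding twist_def
      tensB_lift_mult[OF comm_group_tensBop twist_bal twist_bal that, symmetric]
    by (simp add: case_prod_unfold distrib_left pureBop_add_right)
  \<comment> \<open>By (Uc)Y = U(cY), a factor on the first leg is absorbed into the parameter of
    \<open>twist\<close>.\<close>
  have twist_rmultB: "twist Y (rmultB s t c 1 A) = twist (c * Y) A" if "A \<in> carrier ?T" for Y c A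
  proof -
    have "(twist Y \<circ> rmultB s t c 1) A = twist (c * Y) A"
      by (rule tensB_hom_eqI[OF comm_group.axioms(2)[OF comm_group_tensBop]
            hom_compose[OF rmultB_hom twist_hom] twist_hom _ that])
        (simp add: twist_pure mult.assoc)
    then show ?thesis by simp
  qed

  define \<mu> where "\<mu> = tensor_lift ?O (\<lambda>(X, Y). twist Y (\<Delta> (S X)))"
  \<comment> \<open>S(t(b)X) = S(X)s(b) puts s(b) on the first leg of the coproduct, and
    \<open>twist_rmultB\<close> moves it in front of \<open>Y\<close>.\<close>
  have \<mu>_bal: "balancedB s t ?O (\<lambda>(X, Y). twist Y (\<Delta> (S X)))"
    by (rule balanced_mapI)
      (simp_all add: Delta_closed twist_closed twist_mult twist_add S_add Delta_add S_t Delta_mult_s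
        twist_rmultB)
  have \<mu>_hom: "\<mu> \<in> hom ?T ?O"
    unfolding \<mu>_def by (intro tensB_lift_hom \<mu>_bal) simp
  have \<mu>_pure: "\<mu> (pureB s t X Y) = twist Y (\<Delta> (S X))" for X Y
    unfolding \<mu>_def by (simp add: tensB_lift_pure[OF comm_group_tensBop \<mu>_bal])

  have left: "\<mu> (?gal A) = A" if "A \<in> carrier ?O" for A
  proof -
    have "\<mu> (?gal (pureBop t X Y)) = pureBop t X Y" for X Y
    proof -
      have "\<mu> (?gal (pureBop t X Y)) = tensor_lift ?O (\<lambda>(X1, X2). \<mu> (pureB s t X1 (X2 * Y))) (\<Delta> X)"
        unfolding galois_map_pure rmultB_def
        by (subst tensB_hom_lift[OF _ _ \<mu>_hom balanced_rmultB Delta_closed])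
          (simp_all add: case_prod_unfold)
      \<comment> \<open>The parameter \<open>X2 * Y\<close> is split: \<open>X2\<close> goes back to
        the first leg, which produces the summand of (3) inside \<open>twist Y\<close>.\<close>
      also have "\<dots> = tensor_lift ?O (\<lambda>(X1, X2). twist Y (rmultB s t X2 1 (\<Delta> (S X1)))) (\<Delta> X)"
        by (simp add: \<mu>_pure twist_rmultB Delta_closed)
      \<comment> \<open>\<open>twist Y\<close> is pulled out of the sum over the legs of
        \<open>\<Delta> X\<close>, leaving the left side of (3).\<close>
      also have "\<dots> = twist Y (pureB s t 1 (S X))"
        unfolding cond3 [symmetric]
        by (subst tensB_hom_lift[OF _ _ twist_hom bal3 Delta_closed])
          (simp_all add: case_prod_unfold)
      finally show ?thesis by (simp add: twist_pure)
    qed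
    \<comment> \<open>Both sides are homomorphisms, so agreement on pure tensors suffices.\<close>
    then have "(\<mu> \<circ> ?gal) A = id A"
      by (intro tensBop_hom_eqI[OF comm_group.axioms(2)[OF comm_group_tensBop]
            hom_compose[OF galois_map_hom \<mu>_hom] _ _ that]) (auto simp: hom_def)
    then show ?thesis by simp
  qed
  have right: "?gal (\<mu> A) = A" if "A \<in> carrier ?T" for A
  proof -
    have "?gal (\<mu> (pureB s t X Y)) = pureB s t X Y" for X Y
    proof -
      have "?gal (\<mu> (pureB s t X Y)) =
          tensor_lift ?T (\<lambda>(U, V). ?gal (pureBop t (R V) (U * Y))) (\<Delta> (S X))"
        unfolding \<mu>_pure twist_def
        by (subst tensB_hom_lift[OF _ _ galois_map_hom twist_bal Delta_closed])
          (simp_all add: case_prod_unfold)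
      \<comment> \<open>The second leg is multiplied by UY in two stages, first by \<open>U\<close>
        and then by \<open>Y\<close>; the inner stage is the summand of (2).\<close>
      also have "\<dots> =
          tensor_lift ?T (\<lambda>(U, V). rmultB s t 1 Y (rmultB s t 1 U (\<Delta> (R V)))) (\<Delta> (S X))"
        by (simp add: galois_map_pure rmultB_rmultB Delta_closed)
      \<comment> \<open>Condition (2) at \<open>S X\<close> collapses the sum once right
        multiplication by 1 \<otimes> Y has been pulled out; then \<open>R (S X)\<close> is
        \<open>X\<close>.\<close>
      also have "\<dots> = rmultB s t 1 Y (pureB s t (R (S X)) 1)"
        unfolding cond2 [symmetric]
        by (subst tensB_hom_lift[OF _ _ rmultB_hom bal2 Delta_closed])
          (simp_all add: case_prod_unfold)
      finally show ?thesis by simp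
    qed
    then have "(?gal \<circ> \<mu>) A = id A"
      by (intro tensB_hom_eqI[OF comm_group.axioms(2)[OF comm_group_tensB]
            hom_compose[OF \<mu>_hom galois_map_hom] _ _ that]) (auto simp: hom_def)
    then show ?thesis by simp
  qed

  have bij: "bij_betw ?gal (carrier ?O) (carrier ?T)"
    using galois_map_hom \<mu>_hom left right
    by (intro bij_betw_byWitness[where f' = \<mu>]) (auto simp: hom_def)
  then have "left_hopf_algebroid scaleB scaleL s t \<Delta> \<epsilon>"
    using galois_map_hom by unfold_locales (simp add: iso_def)
  moreover have "inv_into (carrier ?O) ?gal (pureB s t X Y) = twist Y (\<Delta> (S X))" for X Y
  \<comment> \<open>Injectivity of the Galois map makes any preimage in the carrier the value of
    \<open>inv_into\<close>; the preimage is supplied by \<open>right\<close>.\<close>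
  proof (rule inv_into_f_eq)
    show "twist Y (\<Delta> (S X)) \<in> carrier ?O"
      by (simp add: twist_closed Delta_closed)
    show "?gal (twist Y (\<Delta> (S X))) = pureB s t X Y"
      using right[of "pureB s t X Y"] by (simp add: \<mu>_pure)
  qed (use bij in \<open>simp add: bij_betw_def\<close>)
  ultimately show ?thesis
    by (simp add: twist_def R_def)
qed

end
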